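(* Let $(M,g)$ be a light-like manifold with constant index and nullity degree $r$. Assume that $Rad(TM)$ is a trivial bundle, with everywhere linearly independent vector fields $\xi_i\in\Gamma(Rad(TM))$, $i=1,\dots,r$. Let $\tau_i$ ($i=1,\dots,r$) be smooth 1-forms on $M$ satisfying $\tau_i(\xi_j)=\delta_{ij}$ for $i,j=1,\dots,r$. Then $\bar g:=g+\sum_{k=1}^{r}\tau_k\otimes\tau_k$ is a non-degenerate metric on $M$, and the following hold. i) Let $\nabla$ be a linear connection on $M$ with torsion $T$ and with non-metricity $(0,3)$-tensor $Q$ for $g$, i.e. $(\nabla_Zg)(X,Y)=Q(Z,X,Y)$. Assume additionally that $\nabla_X\tau_i=0$ for all $X\in\Gamma(TM)$ and $i=1,\dots,r$. Then for all $X,Y\in\Gamma(TM)$ and $i=1,\dots,r$: $$(d\tau_i)(X,Y)=\tau_i(T(X,Y)),\qquad (1)$$ $$(L_{\xi_i}g)(X,Y)=g(X,T(\xi_i,Y))+g(Y,T(\xi_i,X))+Q(\xi_i,X,Y)-Q(X,Y,\xi_i)-Q(Y,X,\xi_i).\qquad (2)$$ ii) Let $T$ be an anti-symmetric $(1,2)$-tensor field and $Q$ a $(0,3)$-tensor field, symmetric in its last two variables, satisfying (1) and (2) for all $X,Y\in\Gamma(TM)$ and $i=1,\dots,r$. If $\nabla$ is the (unique) linear connection on $M$ with torsion $T$ and with non-metricity $Q$ for $\bar g$ (i.e. $(\nabla_Z\bar g)(X,Y)=Q(Z,X,Y)$), then $\nabla$ also has non-metricity $Q$ with respect to $g$ (i.e.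 $(\nabla_Zg)(X,Y)=Q(Z,X,Y)$), and the 1-forms $\tau_i$ are parallel with respect to $\nabla$ for $i=1,\dots,r$ (i.e. $\nabla_X\tau_i=0$ for all $X\in\Gamma(TM)$).
   Context: A light-like manifold $(M,g)$ is a smooth manifold $M$ with a smooth symmetric $(0,2)$-tensor field $g$ of constant index and constant nullity degree (co-rank). $Rad(TM)$ is the radical of $g$: the subbundle of $TM$ with fibres $Rad(T_xM)=\{v\in T_xM : g(v,w)=0 \text{ for all } w\in T_xM\}$; its rank equals the nullity degree. $\Gamma(E)$ denotes the space of smooth sections of a bundle $E$. $L$ denotes the Lie derivative. The torsion of a linear connection $\nabla$ is $T(X,Y)=\nabla_XY-\nabla_YX-[X,Y]$. A linear connection $\nabla$ has non-metricity $Q$ for a symmetric $(0,2)$-tensor field $h$ if $(\nabla_Zh)(X,Y)=Q(Z,X,Y)$ for all $X,Y,Z\in\Gamma(TM)$. For a given non-degenerate metric on $M$, an anti-symmetric $(1,2)$-tensor field $T$ and a $(0,3)$-tensor field $Q(Z,X,Y)$ symmetric in $X$ and $Y$, there exists a unique linear connection on $M$ with torsion $T$ and non-metricity $Q$ for that metric. Conventions: $(d\tau)(X,Y)=X\tau(Y)-Y\tau(X)-\tau([X,Y])$, $(\nabla_Zh)(X,Y)=Z(h(X,Y))-h(\nabla_ZX,Y)-h(X,\nabla_ZY)$, $(\nabla_X\tau)(Y)=X(\tau(Y))-\tau(\nabla_XY)$, $(L_\xi g)(X,Y)=\xi(g(X,Y))-g([\xi,X],Y)-g(X,[\xi,Y])$.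 *)

theory Defs
  imports "HOL-Analysis.Analysis" "HOL-Library.Function_Algebras"
begin

(* Pointwise real vector space structure on functions; tangent vectors below are
   functions (derivations), and vector fields are functions into tangent vectors. *)

instantiation "fun" :: (type, real_vector) real_vector
begin

definition scaleR_fun :: "real \<Rightarrow> ('a \<Rightarrow> 'b) \<Rightarrow> 'a \<Rightarrow> 'b" where
  "scaleR_fun c f = (\<lambda>x. c *\<^sub>R f x)"

instance
  by standard (simp_all add: scaleR_fun_def fun_eq_iff scaleR_add_right scaleR_add_left)

end

definition linear_on :: "'a::real_vector set \<Rightarrow> ('a \<Rightarrow> 'b::real_vector) \<Rightarrow> bool" where
  "linear_on V f \<longleftrightarrow>
     (\<forall>v\<in>V. \<forall>w\<in>V. f (v + w) = f v + f w) \<and> (\<forall>c. \<forall>v\<in>V. f (c *\<^sub>R v) = c *\<^sub>R f v)"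

(* The library's dim is 0 on infinite-dimensional subspaces, so we ask for a finite basis. *)
definition has_dimension :: "'a::real_vector set \<Rightarrow> nat \<Rightarrow> bool" where
  "has_dimension V m \<longleftrightarrow> (\<exists>B. finite B \<and> independent B \<and> span B = V \<and> card B = m)"

(* C^k functions of n real variables on a set V open in R^n, via iterated partial
   derivatives. Points of R^n are the x :: nat => real with x i = 0 for i >= n. *)
primrec Ck_on :: "nat \<Rightarrow> nat \<Rightarrow> (nat \<Rightarrow> real) set \<Rightarrow> ((nat \<Rightarrow> real) \<Rightarrow> real) \<Rightarrow> bool" where
  "Ck_on n 0 V f \<longleftrightarrow> continuous_map (subtopology (Euclidean_space n) V) euclideanreal f"
| "Ck_on n (Suc k) V f \<longleftrightarrow>
     continuous_map (subtopology (Euclidean_space n) V) euclideanreal f \<and>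
     (\<forall>i<n. \<exists>f'. (\<forall>x\<in>V. ((\<lambda>t. f (x(i := t))) has_real_derivative f' x) (at (x i))) \<and>
                  Ck_on n k V f')"

definition Cinf_on :: "nat \<Rightarrow> (nat \<Rightarrow> real) set \<Rightarrow> ((nat \<Rightarrow> real) \<Rightarrow> real) \<Rightarrow> bool" where
  "Cinf_on n V f \<longleftrightarrow> (\<forall>k. Ck_on n k V f)"

(* The underlying set of a manifold is a whole type 'a, whose class gives the Hausdorff
   and second-countable topology; the record carries the dimension and an atlas
   (not necessarily maximal). A chart is a pair (U, phi). *)
record 'a manifold =
  mdim :: nat
  charts :: "('a set \<times> ('a \<Rightarrow> nat \<Rightarrow> real)) set"

definition smooth_manifold :: "'a::{t2_space, second_countable_topology} manifold \<Rightarrow> bool" where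
  "smooth_manifold M \<longleftrightarrow>
     (\<Union>(U, \<phi>)\<in>charts M. U) = UNIV \<and>
     (\<forall>(U, \<phi>)\<in>charts M.
        open U \<and> openin (Euclidean_space (mdim M)) (\<phi> ` U) \<and>
        homeomorphic_map (top_of_set U) (subtopology (Euclidean_space (mdim M)) (\<phi> ` U)) \<phi>) \<and>
     (\<forall>(U, \<phi>)\<in>charts M. \<forall>(U', \<phi>')\<in>charts M. \<forall>j<mdim M.
        Cinf_on (mdim M) (\<phi> ` (U \<inter> U')) (\<lambda>x. \<phi>' (inv_into U \<phi> x) j))"

definition smooth_functions :: "'a manifold \<Rightarrow> ('a \<Rightarrow> real) set" where
  "smooth_functions M =
     {f. \<forall>(U, \<phi>)\<in>charts M. Cinf_on (mdim M) (\<phi> ` U) (\<lambda>x. f (inv_into U \<phi> x))}"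

type_synonym 'a tvec = "('a \<Rightarrow> real) \<Rightarrow> real"
type_synonym 'a vfield = "'a \<Rightarrow> 'a tvec"

(* Tangent vectors at p: derivations at p of the algebra of smooth functions. The value
   on non-smooth functions is fixed to 0, so that equality of tangent vectors is HOL equality. *)
definition tangent_space :: "'a manifold \<Rightarrow> 'a \<Rightarrow> 'a tvec set" where
  "tangent_space M p = {v.
     (\<forall>f\<in>smooth_functions M. \<forall>h\<in>smooth_functions M. v (\<lambda>x. f x + h x) = v f + v h) \<and>
     (\<forall>c. \<forall>f\<in>smooth_functions M. v (\<lambda>x. c * f x) = c * v f) \<and>
     (\<forall>f\<in>smooth_functions M. \<forall>h\<in>smooth_functions M.
        v (\<lambda>x. f x * h x) = v f * h p + f p * v h) \<and>
     (\<forall>f. f \<notin> smooth_functions M \<longrightarrow> v f = 0)}"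

definition smooth_vfields :: "'a manifold \<Rightarrow> 'a vfield set" where
  "smooth_vfields M = {X. (\<forall>p. X p \<in> tangent_space M p) \<and>
     (\<forall>f\<in>smooth_functions M. (\<lambda>p. X p f) \<in> smooth_functions M)}"

definition bracket :: "'a vfield \<Rightarrow> 'a vfield \<Rightarrow> 'a vfield" where
  "bracket X Y = (\<lambda>p f. X p (\<lambda>q. Y q f) - Y p (\<lambda>q. X q f))"

(* Smooth tensor fields: pointwise multilinear on tangent spaces, and smooth when evaluated
   on global smooth vector fields (by bump functions this is smoothness in every chart;
   likewise for vector fields and global smooth functions). Values on arguments that are not tangent vectors are irrelevant. *)

definition one_form :: "'a manifold \<Rightarrow> ('a \<Rightarrow> 'a tvec \<Rightarrow> real) \<Rightarrow> bool" where
  "one_form M \<tau> \<longleftrightarrow> (\<forall>p. linear_on (tangent_space M p) (\<tau> p)) \<and>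
     (\<forall>X\<in>smooth_vfields M. (\<lambda>p. \<tau> p (X p)) \<in> smooth_functions M)"

definition tensor02 :: "'a manifold \<Rightarrow> ('a \<Rightarrow> 'a tvec \<Rightarrow> 'a tvec \<Rightarrow> real) \<Rightarrow> bool" where
  "tensor02 M g \<longleftrightarrow>
     (\<forall>p. \<forall>v\<in>tangent_space M p.
        linear_on (tangent_space M p) (\<lambda>u. g p u v) \<and> linear_on (tangent_space M p) (g p v)) \<and>
     (\<forall>X\<in>smooth_vfields M. \<forall>Y\<in>smooth_vfields M.
        (\<lambda>p. g p (X p) (Y p)) \<in> smooth_functions M)"

definition tensor03 :: "'a manifold \<Rightarrow> ('a \<Rightarrow> 'a tvec \<Rightarrow> 'a tvec \<Rightarrow> 'a tvec \<Rightarrow> real) \<Rightarrow> bool" where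
  "tensor03 M Q \<longleftrightarrow>
     (\<forall>p. \<forall>v\<in>tangent_space M p. \<forall>w\<in>tangent_space M p.
        linear_on (tangent_space M p) (\<lambda>u. Q p u v w) \<and>
        linear_on (tangent_space M p) (\<lambda>u. Q p v u w) \<and>
        linear_on (tangent_space M p) (Q p v w)) \<and>
     (\<forall>X\<in>smooth_vfields M. \<forall>Y\<in>smooth_vfields M. \<forall>Z\<in>smooth_vfields M.
        (\<lambda>p. Q p (X p) (Y p) (Z p)) \<in> smooth_functions M)"

definition tensor12 :: "'a manifold \<Rightarrow> ('a \<Rightarrow> 'a tvec \<Rightarrow> 'a tvec \<Rightarrow> 'a tvec) \<Rightarrow> bool" where
  "tensor12 M T \<longleftrightarrow>
     (\<forall>p. \<forall>v\<in>tangent_space M p.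
        linear_on (tangent_space M p) (\<lambda>u. T p u v) \<and> linear_on (tangent_space M p) (T p v) \<and>
        (\<forall>w\<in>tangent_space M p. T p v w \<in> tangent_space M p)) \<and>
     (\<forall>X\<in>smooth_vfields M. \<forall>Y\<in>smooth_vfields M.
        (\<lambda>p. T p (X p) (Y p)) \<in> smooth_vfields M)"

definition symmetric02 :: "'a manifold \<Rightarrow> ('a \<Rightarrow> 'a tvec \<Rightarrow> 'a tvec \<Rightarrow> real) \<Rightarrow> bool" where
  "symmetric02 M g \<longleftrightarrow>
     (\<forall>p. \<forall>v\<in>tangent_space M p. \<forall>w\<in>tangent_space M p. g p v w = g p w v)"

definition symmetric_last :: "'a manifold \<Rightarrow> ('a \<Rightarrow> 'a tvec \<Rightarrow> 'a tvec \<Rightarrow> 'a tvec \<Rightarrow> real) \<Rightarrow> bool" where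
  "symmetric_last M Q \<longleftrightarrow> (\<forall>p. \<forall>u\<in>tangent_space M p. \<forall>v\<in>tangent_space M p.
     \<forall>w\<in>tangent_space M p. Q p u v w = Q p u w v)"

definition antisymmetric12 :: "'a manifold \<Rightarrow> ('a \<Rightarrow> 'a tvec \<Rightarrow> 'a tvec \<Rightarrow> 'a tvec) \<Rightarrow> bool" where
  "antisymmetric12 M T \<longleftrightarrow>
     (\<forall>p. \<forall>v\<in>tangent_space M p. \<forall>w\<in>tangent_space M p. T p v w = - T p w v)"

definition radical :: "'a manifold \<Rightarrow> ('a \<Rightarrow> 'a tvec \<Rightarrow> 'a tvec \<Rightarrow> real) \<Rightarrow> 'a \<Rightarrow> 'a tvec set" where
  "radical M g p = {v \<in> tangent_space M p. \<forall>w\<in>tangent_space M p. g p v w = 0}"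

definition negative_subspace ::
    "'a manifold \<Rightarrow> ('a \<Rightarrow> 'a tvec \<Rightarrow> 'a tvec \<Rightarrow> real) \<Rightarrow> 'a \<Rightarrow> 'a tvec set \<Rightarrow> bool" where
  "negative_subspace M g p W \<longleftrightarrow>
     subspace W \<and> W \<subseteq> tangent_space M p \<and> (\<forall>v\<in>W. v \<noteq> 0 \<longrightarrow> g p v v < 0)"

definition has_index :: "'a manifold \<Rightarrow> ('a \<Rightarrow> 'a tvec \<Rightarrow> 'a tvec \<Rightarrow> real) \<Rightarrow> 'a \<Rightarrow> nat \<Rightarrow> bool" where
  "has_index M g p q \<longleftrightarrow>
     (\<exists>W. negative_subspace M g p W \<and> has_dimension W q) \<and>
     (\<forall>W m. negative_subspace M g p W \<and> has_dimension W m \<longrightarrow> m \<le> q)"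

definition light_like_manifold ::
    "'a::{t2_space, second_countable_topology} manifold \<Rightarrow>
     ('a \<Rightarrow> 'a tvec \<Rightarrow> 'a tvec \<Rightarrow> real) \<Rightarrow> nat \<Rightarrow> bool" where
  "light_like_manifold M g r \<longleftrightarrow>
     smooth_manifold M \<and> tensor02 M g \<and> symmetric02 M g \<and>
     (\<exists>q. \<forall>p. has_index M g p q) \<and> (\<forall>p. has_dimension (radical M g p) r)"

definition nondegenerate_metric ::
    "'a manifold \<Rightarrow> ('a \<Rightarrow> 'a tvec \<Rightarrow> 'a tvec \<Rightarrow> real) \<Rightarrow> bool" where
  "nondegenerate_metric M h \<longleftrightarrow>
     tensor02 M h \<and> symmetric02 M h \<and> (\<exists>q. \<forall>p. has_index M h p q) \<and>
     (\<forall>p. radical M h p = {0})"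

definition linear_connection :: "'a manifold \<Rightarrow> ('a vfield \<Rightarrow> 'a vfield \<Rightarrow> 'a vfield) \<Rightarrow> bool" where
  "linear_connection M D \<longleftrightarrow>
     (\<forall>X\<in>smooth_vfields M. \<forall>Y\<in>smooth_vfields M. D X Y \<in> smooth_vfields M) \<and>
     (\<forall>X\<in>smooth_vfields M. \<forall>X'\<in>smooth_vfields M. \<forall>Y\<in>smooth_vfields M.
        D (X + X') Y = D X Y + D X' Y) \<and>
     (\<forall>X\<in>smooth_vfields M. \<forall>Y\<in>smooth_vfields M. \<forall>Y'\<in>smooth_vfields M.
        D X (Y + Y') = D X Y + D X Y') \<and>
     (\<forall>f\<in>smooth_functions M. \<forall>X\<in>smooth_vfields M. \<forall>Y\<in>smooth_vfields M.
        D (\<lambda>p. f p *\<^sub>R X p) Y = (\<lambda>p. f p *\<^sub>R D X Y p)) \<and>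
     (\<forall>f\<in>smooth_functions M. \<forall>X\<in>smooth_vfields M. \<forall>Y\<in>smooth_vfields M.
        D X (\<lambda>p. f p *\<^sub>R Y p) = (\<lambda>p. X p f *\<^sub>R Y p + f p *\<^sub>R D X Y p))"

definition ext_deriv :: "('a \<Rightarrow> 'a tvec \<Rightarrow> real) \<Rightarrow> 'a vfield \<Rightarrow> 'a vfield \<Rightarrow> 'a \<Rightarrow> real" where
  "ext_deriv \<tau> X Y p =
     X p (\<lambda>q. \<tau> q (Y q)) - Y p (\<lambda>q. \<tau> q (X q)) - \<tau> p (bracket X Y p)"

definition lie_deriv ::
    "'a vfield \<Rightarrow> ('a \<Rightarrow> 'a tvec \<Rightarrow> 'a tvec \<Rightarrow> real) \<Rightarrow> 'a vfield \<Rightarrow> 'a vfield \<Rightarrow> 'a \<Rightarrow> real" where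
  "lie_deriv \<xi> g X Y p =
     \<xi> p (\<lambda>q. g q (X q) (Y q)) - g p (bracket \<xi> X p) (Y p) - g p (X p) (bracket \<xi> Y p)"

definition cov_deriv1 ::
    "('a vfield \<Rightarrow> 'a vfield \<Rightarrow> 'a vfield) \<Rightarrow> 'a vfield \<Rightarrow> ('a \<Rightarrow> 'a tvec \<Rightarrow> real) \<Rightarrow>
     'a vfield \<Rightarrow> 'a \<Rightarrow> real" where
  "cov_deriv1 D X \<tau> Y p = X p (\<lambda>q. \<tau> q (Y q)) - \<tau> p (D X Y p)"

definition cov_deriv2 ::
    "('a vfield \<Rightarrow> 'a vfield \<Rightarrow> 'a vfield) \<Rightarrow> 'a vfield \<Rightarrow> ('a \<Rightarrow> 'a tvec \<Rightarrow> 'a tvec \<Rightarrow> real) \<Rightarrow>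
     'a vfield \<Rightarrow> 'a vfield \<Rightarrow> 'a \<Rightarrow> real" where
  "cov_deriv2 D Z h X Y p =
     Z p (\<lambda>q. h q (X q) (Y q)) - h p (D Z X p) (Y p) - h p (X p) (D Z Y p)"

definition has_torsion ::
    "'a manifold \<Rightarrow> ('a vfield \<Rightarrow> 'a vfield \<Rightarrow> 'a vfield) \<Rightarrow>
     ('a \<Rightarrow> 'a tvec \<Rightarrow> 'a tvec \<Rightarrow> 'a tvec) \<Rightarrow> bool" where
  "has_torsion M D T \<longleftrightarrow> (\<forall>X\<in>smooth_vfields M. \<forall>Y\<in>smooth_vfields M. \<forall>p.
     T p (X p) (Y p) = D X Y p - D Y X p - bracket X Y p)"

definition has_nonmetricity ::
    "'a manifold \<Rightarrow> ('a vfield \<Rightarrow> 'a vfield \<Rightarrow> 'a vfield) \<Rightarrow>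
     ('a \<Rightarrow> 'a tvec \<Rightarrow> 'a tvec \<Rightarrow> real) \<Rightarrow>
     ('a \<Rightarrow> 'a tvec \<Rightarrow> 'a tvec \<Rightarrow> 'a tvec \<Rightarrow> real) \<Rightarrow> bool" where
  "has_nonmetricity M D h Q \<longleftrightarrow>
     (\<forall>X\<in>smooth_vfields M. \<forall>Y\<in>smooth_vfields M. \<forall>Z\<in>smooth_vfields M. \<forall>p.
        cov_deriv2 D Z h X Y p = Q p (Z p) (X p) (Y p))"

definition parallel_form ::
    "'a manifold \<Rightarrow> ('a vfield \<Rightarrow> 'a vfield \<Rightarrow> 'a vfield) \<Rightarrow> ('a \<Rightarrow> 'a tvec \<Rightarrow> real) \<Rightarrow> bool" where
  "parallel_form M D \<tau> \<longleftrightarrow>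
     (\<forall>X\<in>smooth_vfields M. \<forall>Y\<in>smooth_vfields M. \<forall>p. cov_deriv1 D X \<tau> Y p = 0)"

end

theory Submission
  imports Defs
begin

text \<open>
  Write \<open>h = g + \<Sum> \<tau>\<^sub>k \<otimes> \<tau>\<^sub>k\<close>. Since \<open>\<xi>\<^sub>i\<close> lies in the radical of \<open>g\<close> and \<open>(\<xi>, \<tau>)\<close> is a
  dual pair, \<open>h(X, \<xi>\<^sub>i) = \<tau>\<^sub>i(X)\<close>. So a vector in the radical of \<open>h\<close> is annihilated by all
  \<open>\<tau>\<^sub>i\<close>, hence lies in the radical of \<open>g\<close>, which the \<open>\<xi>\<^sub>i\<close> span, and therefore vanishes. The
  added squares do not change the index: \<open>h \<ge> g\<close>, so the subspaces negative for \<open>h\<close> are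
  negative for \<open>g\<close>; and the projection \<open>v \<mapsto> v - \<Sum> \<tau>\<^sub>k(v) \<xi>\<^sub>k\<close> carries a subspace negative for
  \<open>g\<close> injectively to one that is negative for \<open>h\<close>, since it does not change \<open>g(v, v)\<close> and its
  values are annihilated by all \<open>\<tau>\<^sub>k\<close>. Thus \<open>h\<close> is a non-degenerate metric of constant index
  (\<open>radical_gbar\<close>, \<open>index_gbar\<close>).

  The two formulas relate brackets to the connection: substituting
  \<open>[X, Y] = \<nabla>\<^sub>X Y - \<nabla>\<^sub>Y X - T(X, Y)\<close> into \<open>d\<tau>\<close> and \<open>L\<^sub>\<zeta> h\<close> gives \<open>ext_deriv_eq\<close> and \<open>lie_deriv_eq\<close>,
  that is
  \<open>(d\<tau>)(X, Y) = (\<nabla>\<^sub>X \<tau>)(Y) - (\<nabla>\<^sub>Y \<tau>)(X) + \<tau>(T(X, Y))\<close> and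
  \<open>(L\<^sub>\<zeta> h)(X, Y) = (\<nabla>\<^sub>\<zeta> h)(X, Y) + h(\<nabla>\<^sub>X \<zeta>, Y) + h(X, \<nabla>\<^sub>Y \<zeta>) + h(T(\<zeta>, X), Y) + h(X, T(\<zeta>, Y))\<close>.
  For parallel \<open>\<tau>\<^sub>i\<close> the first one is the formula for \<open>d\<tau>\<^sub>i\<close>. If \<open>\<nabla>\<close> has non-metricity \<open>Q\<close> for
  \<open>g\<close>, then \<open>Q(X, Y, \<xi>\<^sub>i) = - g(Y, \<nabla>\<^sub>X \<xi>\<^sub>i)\<close> because \<open>\<xi>\<^sub>i\<close> is radical, and the second one is the
  formula for \<open>L\<^sub>\<xi> g\<close>.

  For the converse, suppose that \<open>\<nabla>\<close> has non-metricity \<open>Q\<close> for \<open>h\<close>. The formula for \<open>d\<tau>\<^sub>i\<close>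
  says that the bilinear form \<open>\<nabla>\<tau>\<^sub>i\<close> is symmetric. Now
  \<open>Q(X, Y, \<xi>\<^sub>i) = (\<nabla>\<^sub>X \<tau>\<^sub>i)(Y) - h(Y, \<nabla>\<^sub>X \<xi>\<^sub>i)\<close>, so that \<open>L\<^sub>\<xi> h\<close> differs from the right-hand
  side of the formula for \<open>L\<^sub>\<xi> g\<close>, with \<open>h\<close> in place of \<open>g\<close>, by
  \<open>(\<nabla>\<^sub>X \<tau>\<^sub>i)(Y) + (\<nabla>\<^sub>Y \<tau>\<^sub>i)(X)\<close>. On the other hand the formula for \<open>L\<^sub>\<xi> g\<close> passes to \<open>h\<close>
  without any correction, because \<open>L\<^sub>\<xi> \<tau>\<^sub>k = d\<tau>\<^sub>k(\<xi>\<^sub>i, _) = \<tau>\<^sub>k(T(\<xi>\<^sub>i, _))\<close>. Hence \<open>\<nabla>\<tau>\<^sub>i\<close> is also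
  skew, so it is zero, and then \<open>\<nabla>g = \<nabla>h\<close> (\<open>\<tau>_parallel\<close>, \<open>nonmetricity_g_iff_gbar\<close>).
\<close>

section \<open>The algebra of smooth functions\<close>

lemma Ck_on_const: "Ck_on n k V (\<lambda>x. c)"
proof (induction k arbitrary: c)
  case (Suc k)
  have "\<exists>f'. (\<forall>x\<in>V. ((\<lambda>t. c) has_real_derivative f' x) (at (x i))) \<and> Ck_on n k V f'" for i
    by (rule exI[of _ "\<lambda>x. 0"]) (simp add: Suc)
  then show ?case by simp
qed simp

lemma Ck_on_partial:
  assumes "Ck_on n (Suc k) V f" "i < n"
  obtains f' where "\<And>x. x \<in> V \<Longrightarrow> ((\<lambda>t. f (x(i := t))) has_real_derivative f' x) (at (x i))"
    and "Ck_on n k V f'"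
  using assms unfolding Ck_on.simps by blast

text \<open>The product rule below needs the factors themselves, and not only their partial derivatives,
  one order of differentiability lower.\<close>

lemma Ck_on_Suc_imp: "Ck_on n (Suc k) V f \<Longrightarrow> Ck_on n k V f"
proof (induction k arbitrary: f)
  case (Suc k)
  then show ?case
    unfolding Ck_on.simps(2)[of n "Suc k"] Ck_on.simps(2)[of n k] by blast
qed simp

lemma Ck_on_add:
  assumes "Ck_on n k V f" "Ck_on n k V h"
  shows "Ck_on n k V (\<lambda>x. f x + h x)"
  using assms
proof (induction k arbitrary: f h)
  case 0
  then show ?case by (simp add: continuous_map_add)
next
  case (Suc k)
  have "\<exists>d. (\<forall>x\<in>V. ((\<lambda>t. f (x(i := t)) + h (x(i := t))) has_real_derivative d x) (at (x i)))
            \<and> Ck_on n k V d" if i: "i < n" for i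
  proof -
    obtain f' where f':
      "\<And>x. x \<in> V \<Longrightarrow> ((\<lambda>t. f (x(i := t))) has_real_derivative f' x) (at (x i))" "Ck_on n k V f'"
      using Ck_on_partial[OF Suc.prems(1) i] by blast
    obtain h' where h':
      "\<And>x. x \<in> V \<Longrightarrow> ((\<lambda>t. h (x(i := t))) has_real_derivative h' x) (at (x i))" "Ck_on n k V h'"
      using Ck_on_partial[OF Suc.prems(2) i] by blast
    show ?thesis
      by (intro exI[of _ "\<lambda>x. f' x + h' x"] conjI ballI DERIV_add Suc.IH f' h')
  qed
  moreover have "continuous_map (subtopology (Euclidean_space n) V) euclideanreal (\<lambda>x. f x + h x)"
    using Suc.prems by (intro continuous_map_add) simp_all
  ultimately show ?case unfolding Ck_on.simps by blast
qed

lemma Ck_on_mult: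
  assumes "Ck_on n k V f" "Ck_on n k V h"
  shows "Ck_on n k V (\<lambda>x. f x * h x)"
  using assms
proof (induction k arbitrary: f h)
  case 0
  then show ?case by (simp add: continuous_map_real_mult)
next
  case (Suc k)
  have "\<exists>d. (\<forall>x\<in>V. ((\<lambda>t. f (x(i := t)) * h (x(i := t))) has_real_derivative d x) (at (x i)))
            \<and> Ck_on n k V d" if i: "i < n" for i
  proof -
    obtain f' where f':
      "\<And>x. x \<in> V \<Longrightarrow> ((\<lambda>t. f (x(i := t))) has_real_derivative f' x) (at (x i))" "Ck_on n k V f'"
      using Ck_on_partial[OF Suc.prems(1) i] by blast
    obtain h' where h':
      "\<And>x. x \<in> V \<Longrightarrow> ((\<lambda>t. h (x(i := t))) has_real_derivative h' x) (at (x i))" "Ck_on n k V h'"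
      using Ck_on_partial[OF Suc.prems(2) i] by blast
    have "Ck_on n k V (\<lambda>x. f' x * h x + h' x * f x)"
      by (intro Ck_on_add Suc.IH f' h' Ck_on_Suc_imp[OF Suc.prems(1)] Ck_on_Suc_imp[OF Suc.prems(2)])
    moreover have "((\<lambda>t. f (x(i := t)) * h (x(i := t))) has_real_derivative f' x * h x + h' x * f x)
        (at (x i))" if "x \<in> V" for x
      using DERIV_mult[OF f'(1)[OF that] h'(1)[OF that]] by simp
    ultimately show ?thesis
      by (intro exI[of _ "\<lambda>x. f' x * h x + h' x * f x"]) auto
  qed
  moreover have "continuous_map (subtopology (Euclidean_space n) V) euclideanreal (\<lambda>x. f x * h x)"
    using Suc.prems by (intro continuous_map_real_mult) simp_all
  ultimately show ?case unfolding Ck_on.simps by blast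
qed

lemma smooth_functions_const: "(\<lambda>x. c) \<in> smooth_functions M"
  by (auto simp: smooth_functions_def Cinf_on_def Ck_on_const)

lemma smooth_functions_add:
  "f \<in> smooth_functions M \<Longrightarrow> h \<in> smooth_functions M \<Longrightarrow> (\<lambda>x. f x + h x) \<in> smooth_functions M"
  by (fastforce simp: smooth_functions_def Cinf_on_def intro: Ck_on_add)

lemma smooth_functions_mult:
  "f \<in> smooth_functions M \<Longrightarrow> h \<in> smooth_functions M \<Longrightarrow> (\<lambda>x. f x * h x) \<in> smooth_functions M"
  by (fastforce simp: smooth_functions_def Cinf_on_def intro: Ck_on_mult)

lemma smooth_functions_sum:
  "(\<And>i. i \<in> I \<Longrightarrow> f i \<in> smooth_functions M) \<Longrightarrow> (\<lambda>x. \<Sum>i\<in>I. f i x) \<in> smooth_functions M"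
  by (induction I rule: infinite_finite_induct)
     (auto intro: smooth_functions_const smooth_functions_add)


section \<open>Tangent vectors as derivations\<close>

lemma tangent_add:
  "v \<in> tangent_space M p \<Longrightarrow> f \<in> smooth_functions M \<Longrightarrow> h \<in> smooth_functions M
    \<Longrightarrow> v (\<lambda>x. f x + h x) = v f + v h"
  by (simp add: tangent_space_def)

lemma tangent_mult:
  "v \<in> tangent_space M p \<Longrightarrow> f \<in> smooth_functions M \<Longrightarrow> h \<in> smooth_functions M
    \<Longrightarrow> v (\<lambda>x. f x * h x) = v f * h p + f p * v h"
  by (simp add: tangent_space_def)

lemma tangent_scale:
  "v \<in> tangent_space M p \<Longrightarrow> f \<in> smooth_functions M \<Longrightarrow> v (\<lambda>x. c * f x) = c * v f"
  by (simp add: tangent_space_def)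

text \<open>The Leibniz rule for \<open>1 = 1 \<cdot> 1\<close> gives \<open>v(1) = 2 v(1)\<close>.\<close>

lemma tangent_const:
  assumes "v \<in> tangent_space M p"
  shows "v (\<lambda>x. c) = 0"
proof -
  have "v (\<lambda>x. 1) = 0"
    using tangent_mult[OF assms smooth_functions_const smooth_functions_const, of 1 1] by simp
  moreover have "v (\<lambda>x. c * 1) = c * v (\<lambda>x. 1)"
    by (rule tangent_scale[OF assms smooth_functions_const])
  ultimately show ?thesis by simp
qed

lemma tangent_sum:
  assumes "v \<in> tangent_space M p" "\<And>i. i \<in> I \<Longrightarrow> f i \<in> smooth_functions M"
  shows "v (\<lambda>x. \<Sum>i\<in>I. f i x) = (\<Sum>i\<in>I. v (f i))"
  using assms(2)
  by (induction I rule: infinite_finite_induct)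
     (auto simp: tangent_const[OF assms(1)] tangent_add[OF assms(1)] smooth_functions_sum)

lemma subspace_tangent_space: "subspace (tangent_space M p)"
  unfolding subspace_def tangent_space_def
  by (auto simp: scaleR_fun_def zero_fun_def plus_fun_def algebra_simps)

lemma smooth_vfieldD: "X \<in> smooth_vfields M \<Longrightarrow> X p \<in> tangent_space M p"
  by (simp add: smooth_vfields_def)


section \<open>Linear algebra on subspaces\<close>

lemma linear_on_diff:
  assumes "linear_on V f" "subspace V" "u \<in> V" "v \<in> V"
  shows "f (u - v) = f u - f v"
proof -
  have "f (u + (-1) *\<^sub>R v) = f u + (-1) *\<^sub>R f v"
    using assms unfolding linear_on_def by (metis subspace_scale)
  then show ?thesis by simp
qed

lemma linear_on_zero: "linear_on V f \<Longrightarrow> subspace V \<Longrightarrow> f 0 = 0"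
  using linear_on_diff[of V f 0 0] by (simp add: subspace_0)

lemma linear_on_sum:
  assumes "linear_on V f" "subspace V" "\<And>i. i \<in> I \<Longrightarrow> v i \<in> V"
  shows "f (\<Sum>i\<in>I. c i *\<^sub>R v i) = (\<Sum>i\<in>I. c i *\<^sub>R f (v i))"
  using assms(3)
proof (induction I rule: infinite_finite_induct)
  case (insert i I)
  have "(\<Sum>i\<in>I. c i *\<^sub>R v i) \<in> V"
    using insert.prems assms(2) by (intro subspace_sum subspace_scale) auto
  then show ?case
    using insert assms(1,2) by (simp add: linear_on_def subspace_scale)
qed (simp_all add: linear_on_zero[OF assms(1,2)])

lemma linear_on_add:
  "linear_on V f \<Longrightarrow> linear_on V h \<Longrightarrow> linear_on V (\<lambda>v. f v + h v)"
  by (simp add: linear_on_def scaleR_add_right)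

lemma linear_on_weighted_sum:
  fixes h :: "'i \<Rightarrow> 'b::real_vector \<Rightarrow> real"
  assumes "\<And>k. k \<in> I \<Longrightarrow> linear_on V (h k)"
  shows "linear_on V (\<lambda>v. \<Sum>k\<in>I. a k * h k v)" "linear_on V (\<lambda>v. \<Sum>k\<in>I. h k v * a k)"
proof -
  have zero: "linear_on V (\<lambda>v. 0 :: real)"
    by (simp add: linear_on_def)
  have scale: "linear_on V (\<lambda>v. a k * h k v)" if "k \<in> I" for k
    using assms[OF that] by (simp add: linear_on_def distrib_left)
  show "linear_on V (\<lambda>v. \<Sum>k\<in>I. a k * h k v)"
    using scale
    by (induction I rule: infinite_finite_induct) (simp_all add: zero linear_on_add)
  then show "linear_on V (\<lambda>v. \<Sum>k\<in>I. h k v * a k)"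
    by (simp add: mult.commute)
qed

text \<open>A map that is linear only on \<open>W\<close> agrees there with a globally linear map, the linear
  extension of its values on a basis of \<open>W\<close>; this makes the results on linear maps applicable.\<close>

lemma has_dimension_linear_image:
  assumes "has_dimension W m" "linear_on W f" "inj_on f W"
  shows "subspace (f ` W)" "has_dimension (f ` W) m"
proof -
  obtain B where B: "finite B" "independent B" "span B = W" "card B = m"
    using assms(1) by (auto simp: has_dimension_def)
  obtain L where L: "linear L" "\<forall>b\<in>B. L b = f b"
    using linear_independent_extend[OF B(2)] by blast
  have eq: "w \<in> W \<and> L w = f w" if "w \<in> span B" for w
    using that
  proof (induction rule: span_induct_alt)
    case base
    show ?case
      using linear_on_zero[OF assms(2)] L(1) B(3) by (metis linear_0 span_zero subspace_span)
  next
    case (step c b w)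
    then have W: "b \<in> W" "w \<in> W" "c *\<^sub>R b \<in> W" "c *\<^sub>R b + w \<in> W"
      using B(3) by (auto simp: span_base span_scale intro: span_add)
    then show ?case
      using step L assms(2) by (simp add: linear_add linear_scale linear_on_def)
  qed
  then have img: "L ` W = f ` W" and inj: "inj_on L (span B)"
    using B(3) assms(3) by (auto simp: inj_on_def)
  have "span (L ` B) = f ` W"
    using linear_span_image[OF L(1), of B] B(3) img by simp
  moreover have "independent (L ` B)"
    using linear_independent_injective_image[OF L(1) B(2)] inj by simp
  moreover have "card (L ` B) = m"
    using B inj by (metis card_image inj_on_subset span_superset)
  ultimately show "subspace (f ` W)" "has_dimension (f ` W) m"
    using B(1) unfolding has_dimension_def by (metis subspace_span, blast)
qed

text \<open>If some \<open>x\<close> in \<open>V\<close> were outside the span of the family, adjoining it would give \<open>r + 1\<close>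
  independent vectors in the span of \<open>r\<close> vectors. The coefficients are indexed by the family and
  not by its set of values, so its injectivity is proved first.\<close>

lemma independent_family_spans:
  fixes v :: "nat \<Rightarrow> 'b::real_vector"
  assumes dim: "has_dimension V r"
    and mem: "\<And>i. i \<in> {1..r} \<Longrightarrow> v i \<in> V"
    and indep: "\<And>c. (\<Sum>i=1..r. c i *\<^sub>R v i) = 0 \<Longrightarrow> \<forall>i\<in>{1..r}. c i = 0"
    and "x \<in> V"
  obtains c where "x = (\<Sum>i=1..r. c i *\<^sub>R v i)"
proof -
  obtain B where B: "finite B" "independent B" "span B = V" "card B = r"
    using dim by (auto simp: has_dimension_def)
  have inj: "inj_on v {1..r}"
  proof (rule inj_onI, rule ccontr)
    fix i j assume ij: "i \<in> {1..r}" "j \<in> {1..r}" "v i = v j" "i \<noteq> j"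
    define c where "c k = (if k = i then 1 else 0) - (if k = j then 1 else (0::real))" for k
    have "(\<Sum>k=1..r. c k *\<^sub>R v k) = (\<Sum>k=1..r. (if k = i then v k else 0) - (if k = j then v k else 0))"
      by (intro sum.cong) (auto simp: c_def)
    also have "\<dots> = v i - v j"
      using ij by (simp add: sum_subtractf)
    finally have "(\<Sum>k=1..r. c k *\<^sub>R v k) = 0" using ij by simp
    with indep ij(1) have "c i = 0" by blast
    with ij(4) show False by (simp add: c_def)
  qed
  have ind: "independent (v ` {1..r})"
  proof
    assume "dependent (v ` {1..r})"
    then obtain u where u: "\<exists>w\<in>v ` {1..r}. u w \<noteq> 0" "(\<Sum>w\<in>v ` {1..r}. u w *\<^sub>R w) = 0"
      by (auto simp: dependent_finite)
    have "(\<Sum>i=1..r. u (v i) *\<^sub>R v i) = 0"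
      using u(2) sum.reindex[OF inj, of "\<lambda>w. u w *\<^sub>R w"] by (simp add: o_def)
    from indep[OF this] u(1) show False by auto
  qed
  have "x \<in> span (v ` {1..r})"
  proof (rule ccontr)
    assume x: "x \<notin> span (v ` {1..r})"
    then have "independent (insert x (v ` {1..r}))"
      using ind by (simp add: independent_insert)
    moreover have "insert x (v ` {1..r}) \<subseteq> span B"
      using B(3) mem \<open>x \<in> V\<close> by auto
    ultimately have "card (insert x (v ` {1..r})) \<le> card B"
      using independent_span_bound[OF B(1)] by blast
    moreover have "x \<notin> v ` {1..r}"
      using x by (metis span_base)
    then have "card (insert x (v ` {1..r})) = Suc r"
      using card_image[OF inj] by simp
    ultimately show False
      using B(4) by simp
  qed
  then obtain u where "x = (\<Sum>w\<in>v ` {1..r}. u w *\<^sub>R w)"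
    unfolding span_finite[OF finite_imageI[OF finite_atLeastAtMost]] by (rule rangeE)
  then have "x = (\<Sum>i=1..r. u (v i) *\<^sub>R v i)"
    using sum.reindex[OF inj, of "\<lambda>w. u w *\<^sub>R w"] by (simp add: o_def)
  then show thesis by (rule that)
qed


section \<open>The completed metric\<close>

definition completed_metric ::
    "('a \<Rightarrow> 'a tvec \<Rightarrow> 'a tvec \<Rightarrow> real) \<Rightarrow> nat \<Rightarrow> (nat \<Rightarrow> 'a \<Rightarrow> 'a tvec \<Rightarrow> real) \<Rightarrow>
     'a \<Rightarrow> 'a tvec \<Rightarrow> 'a tvec \<Rightarrow> real" where
  "completed_metric g r \<tau> = (\<lambda>p v w. g p v w + (\<Sum>k=1..r. \<tau> k p v * \<tau> k p w))"

lemma tensor02_completed_metric: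
  assumes g: "tensor02 M g" and \<tau>: "\<And>k. k \<in> {1..r} \<Longrightarrow> one_form M (\<tau> k)"
  shows "tensor02 M (completed_metric g r \<tau>)"
proof -
  have "linear_on (tangent_space M p) (\<tau> k p)" if "k \<in> {1..r}" for k p
    using \<tau>[OF that] by (simp add: one_form_def)
  moreover have "(\<lambda>p. \<tau> k p (X p)) \<in> smooth_functions M" if "k \<in> {1..r}" "X \<in> smooth_vfields M" for k X
    using \<tau>[OF that(1)] that(2) by (simp add: one_form_def)
  ultimately show ?thesis
    using g unfolding tensor02_def completed_metric_def
    by (intro conjI ballI allI linear_on_add linear_on_weighted_sum smooth_functions_add
        smooth_functions_sum smooth_functions_mult) blast+
qed

text \<open>The frame \<open>\<xi>\<close> of radical vector fields and the dual forms \<open>\<tau>\<close> split the tangent spaces as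
  the span of the frame plus the common kernel of the forms, the screen.\<close>

locale split_degenerate_form =
  fixes M :: "'a manifold"
    and g :: "'a \<Rightarrow> 'a tvec \<Rightarrow> 'a tvec \<Rightarrow> real"
    and r :: nat
    and \<xi> :: "nat \<Rightarrow> 'a vfield"
    and \<tau> :: "nat \<Rightarrow> 'a \<Rightarrow> 'a tvec \<Rightarrow> real"
  assumes g: "tensor02 M g" "symmetric02 M g"
    and \<xi>_radical: "\<And>i p. i \<in> {1..r} \<Longrightarrow> \<xi> i p \<in> radical M g p"
    and \<tau>: "\<And>i. i \<in> {1..r} \<Longrightarrow> one_form M (\<tau> i)"
    and dual: "\<And>i j p. i \<in> {1..r} \<Longrightarrow> j \<in> {1..r} \<Longrightarrow> \<tau> i p (\<xi> j p) = (if i = j then 1 else 0)"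
begin

abbreviation gbar where "gbar \<equiv> completed_metric g r \<tau>"

lemma \<xi>_tangent: "i \<in> {1..r} \<Longrightarrow> \<xi> i p \<in> tangent_space M p"
  using \<xi>_radical by (auto simp: radical_def)

lemma g_sym: "v \<in> tangent_space M p \<Longrightarrow> w \<in> tangent_space M p \<Longrightarrow> g p v w = g p w v"
  using g(2) by (simp add: symmetric02_def)

lemma g_\<xi>:
  assumes "i \<in> {1..r}" "w \<in> tangent_space M p"
  shows "g p (\<xi> i p) w = 0" "g p w (\<xi> i p) = 0"
  using assms \<xi>_radical[OF assms(1)] g_sym[OF assms(2) \<xi>_tangent[OF assms(1)]]
  by (auto simp: radical_def)

lemma \<tau>_linear: "i \<in> {1..r} \<Longrightarrow> linear_on (tangent_space M p) (\<tau> i p)"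
  using \<tau> by (auto simp: one_form_def)

lemma gbar_tensor: "tensor02 M gbar"
  by (rule tensor02_completed_metric[OF g(1) \<tau>])

lemma gbar_symmetric: "symmetric02 M gbar"
  using g(2) by (simp add: symmetric02_def completed_metric_def mult.commute)

text \<open>The \<open>\<tau>\<^sub>i\<close> are the metric duals of the \<open>\<xi>\<^sub>i\<close> for the completed metric: the summand \<open>g\<close> vanishes
  on the radical, and duality leaves only the summand with index \<open>i\<close>.\<close>

lemma gbar_\<xi>:
  assumes "i \<in> {1..r}" "w \<in> tangent_space M p"
  shows "gbar p w (\<xi> i p) = \<tau> i p w"
proof -
  have "(\<Sum>k=1..r. \<tau> k p w * \<tau> k p (\<xi> i p)) = (\<Sum>k=1..r. if k = i then \<tau> k p w else 0)"
    using assms(1) by (intro sum.cong) (auto simp: dual)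
  then show ?thesis
    using assms by (simp add: completed_metric_def g_\<xi>)
qed

definition screen_projection :: "'a \<Rightarrow> 'a tvec \<Rightarrow> 'a tvec" where
  "screen_projection p v = v - (\<Sum>k=1..r. \<tau> k p v *\<^sub>R \<xi> k p)"

lemma screen_projection_tangent:
  "v \<in> tangent_space M p \<Longrightarrow> screen_projection p v \<in> tangent_space M p"
  unfolding screen_projection_def
  by (intro subspace_diff subspace_sum subspace_scale subspace_tangent_space \<xi>_tangent)

lemma linear_on_screen_projection: "linear_on (tangent_space M p) (screen_projection p)"
proof -
  have add: "(\<Sum>k=1..r. \<tau> k p (v + w) *\<^sub>R \<xi> k p)
      = (\<Sum>k=1..r. \<tau> k p v *\<^sub>R \<xi> k p) + (\<Sum>k=1..r. \<tau> k p w *\<^sub>R \<xi> k p)"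
    if "v \<in> tangent_space M p" "w \<in> tangent_space M p" for v w
    unfolding sum.distrib[symmetric] scaleR_add_left[symmetric]
    using \<tau>_linear that by (intro sum.cong) (auto simp: linear_on_def)
  have scale: "(\<Sum>k=1..r. \<tau> k p (c *\<^sub>R v) *\<^sub>R \<xi> k p) = c *\<^sub>R (\<Sum>k=1..r. \<tau> k p v *\<^sub>R \<xi> k p)"
    if "v \<in> tangent_space M p" for c v
    unfolding scaleR_sum_right
    using \<tau>_linear that by (intro sum.cong) (auto simp: linear_on_def)
  show ?thesis
    unfolding linear_on_def screen_projection_def 
    by (simp del: One_nat_def add: add scale scaleR_diff_right)
qed

lemma \<tau>_screen_projection:
  assumes "i \<in> {1..r}" "v \<in> tangent_space M p"
  shows "\<tau> i p (screen_projection p v) = 0"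
proof -
  let ?s = "\<Sum>k=1..r. \<tau> k p v *\<^sub>R \<xi> k p"
  have "\<tau> i p ?s = (\<Sum>k=1..r. \<tau> k p v *\<^sub>R \<tau> i p (\<xi> k p))"
    by (rule linear_on_sum[OF \<tau>_linear[OF assms(1)] subspace_tangent_space \<xi>_tangent])
  also have "\<dots> = (\<Sum>k=1..r. if k = i then \<tau> k p v else 0)"
    using assms(1) by (intro sum.cong) (auto simp: dual)
  finally have "\<tau> i p ?s = \<tau> i p v" using assms(1) by simp
  moreover have "?s \<in> tangent_space M p"
    by (intro subspace_sum subspace_scale subspace_tangent_space \<xi>_tangent)
  ultimately show ?thesis
    using linear_on_diff[OF \<tau>_linear[OF assms(1)] subspace_tangent_space assms(2)]
    by (simp add: screen_projection_def)
qed

lemma g_screen_projection_left: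
  assumes "v \<in> tangent_space M p" "w \<in> tangent_space M p"
  shows "g p (screen_projection p v) w = g p v w"
proof -
  let ?s = "\<Sum>k=1..r. \<tau> k p v *\<^sub>R \<xi> k p"
  have lin: "linear_on (tangent_space M p) (\<lambda>u. g p u w)"
    using g(1) assms(2) by (auto simp: tensor02_def)
  have "g p ?s w = (\<Sum>k=1..r. \<tau> k p v *\<^sub>R g p (\<xi> k p) w)"
    using linear_on_sum[OF lin subspace_tangent_space, of "{1..r}" "\<lambda>k. \<xi> k p"] \<xi>_tangent by simp
  also have "\<dots> = 0"
    using assms by (simp add: g_\<xi>)
  finally have "g p ?s w = 0" .
  moreover have "?s \<in> tangent_space M p"
    by (intro subspace_sum subspace_scale subspace_tangent_space \<xi>_tangent)
  ultimately show ?thesis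
    using linear_on_diff[OF lin subspace_tangent_space assms(1)]
    by (simp add: screen_projection_def)
qed

lemma gbar_screen_projection:
  assumes "v \<in> tangent_space M p"
  shows "gbar p (screen_projection p v) (screen_projection p v) = g p v v"
proof -
  have "gbar p (screen_projection p v) (screen_projection p v)
      = g p (screen_projection p v) (screen_projection p v)"
    using assms by (simp add: completed_metric_def \<tau>_screen_projection)
  also have "\<dots> = g p v (screen_projection p v)"
    using assms by (intro g_screen_projection_left screen_projection_tangent)
  also have "\<dots> = g p (screen_projection p v) v"
    using assms by (intro g_sym screen_projection_tangent)
  also have "\<dots> = g p v v"
    using assms by (intro g_screen_projection_left)
  finally show ?thesis .
qed

text \<open>Negative subspaces for the two forms correspond: in one direction by projecting to the screen,
  in the other without change. The projection is injective on a subspace negative for \<open>g\<close> since it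
  preserves \<open>g(v, v)\<close>, which is nonzero there unless \<open>v = 0\<close>.\<close>

lemma index_gbar:
  assumes "has_index M g p q"
  shows "has_index M gbar p q"
  unfolding has_index_def
proof (intro conjI allI impI)
  obtain W where W: "negative_subspace M g p W" "has_dimension W q"
    using assms by (auto simp: has_index_def)
  have sub: "subspace W" "W \<subseteq> tangent_space M p" and neg: "\<And>v. v \<in> W \<Longrightarrow> v \<noteq> 0 \<Longrightarrow> g p v v < 0"
    using W(1) by (auto simp: negative_subspace_def)
  let ?\<pi> = "screen_projection p"
  have lin: "linear_on W ?\<pi>"
    using linear_on_screen_projection sub(2) unfolding linear_on_def by blast
  have \<pi>0: "?\<pi> 0 = 0"
    by (rule linear_on_zero[OF lin sub(1)])
  have gbar0: "gbar p 0 0 = 0"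
    using gbar_tensor linear_on_zero[OF _ subspace_tangent_space, of M p "gbar p 0"]
      subspace_0[OF subspace_tangent_space, of M p]
    by (auto simp: tensor02_def)
  have ker: "v = 0" if "v \<in> W" "?\<pi> v = 0" for v
    using gbar_screen_projection[of v p] neg[OF that(1)] that sub(2) gbar0 by force
  have inj: "inj_on ?\<pi> W"
  proof (rule inj_onI)
    fix v w assume vw: "v \<in> W" "w \<in> W" "?\<pi> v = ?\<pi> w"
    then have "?\<pi> (v - w) = 0"
      by (simp add: linear_on_diff[OF lin sub(1)])
    then show "v = w"
      using ker[of "v - w"] vw sub(1) by (simp add: subspace_diff)
  qed
  have "negative_subspace M gbar p (?\<pi> ` W)"
    unfolding negative_subspace_def
  proof (intro conjI ballI impI)
    show "subspace (?\<pi> ` W)"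
      by (rule has_dimension_linear_image(1)[OF W(2) lin inj])
    show "?\<pi> ` W \<subseteq> tangent_space M p"
      using sub(2) screen_projection_tangent by auto
    fix u assume "u \<in> ?\<pi> ` W" "u \<noteq> 0"
    then obtain v where v: "v \<in> W" "u = ?\<pi> v" by blast
    then have "v \<noteq> 0" using \<open>u \<noteq> 0\<close> \<pi>0 by auto
    then show "gbar p u u < 0"
      using v neg sub(2) gbar_screen_projection[of v p] by auto
  qed
  moreover have "has_dimension (?\<pi> ` W) q"
    by (rule has_dimension_linear_image(2)[OF W(2) lin inj])
  ultimately show "\<exists>W. negative_subspace M gbar p W \<and> has_dimension W q" by blast
next
  fix W m assume W: "negative_subspace M gbar p W \<and> has_dimension W m"
  have "g p v v \<le> gbar p v v" for v
    by (simp add: completed_metric_def sum_nonneg)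
  then have "negative_subspace M g p W"
    using W unfolding negative_subspace_def by (auto intro: order_le_less_trans)
  then show "m \<le> q"
    using assms W unfolding has_index_def by blast
qed

text \<open>Pairing with \<open>\<xi>\<^sub>i\<close> shows \<open>\<tau>\<^sub>i(v) = 0\<close> for \<open>v\<close> in the radical of the completed metric, so \<open>v\<close>
  is in the radical of \<open>g\<close> and equals its own screen projection. But the projection kills the
  \<open>\<xi>\<^sub>i\<close>, which span the radical of \<open>g\<close>.\<close>

lemma radical_gbar:
  assumes "has_dimension (radical M g p) r"
    and "\<And>c. (\<Sum>i=1..r. c i *\<^sub>R \<xi> i p) = 0 \<Longrightarrow> \<forall>i\<in>{1..r}. c i = 0"
  shows "radical M gbar p = {0}"
proof
  show "radical M gbar p \<subseteq> {0}"
  proof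
    fix v assume v: "v \<in> radical M gbar p"
    then have tv: "v \<in> tangent_space M p" by (simp add: radical_def)
    have \<tau>v: "\<tau> i p v = 0" if "i \<in> {1..r}" for i
      using gbar_\<xi>[OF that tv] v \<xi>_tangent[OF that] by (simp add: radical_def)
    then have "v \<in> radical M g p"
      using v by (simp add: radical_def completed_metric_def)
    then obtain c where c: "v = (\<Sum>i=1..r. c i *\<^sub>R \<xi> i p)"
      using independent_family_spans[OF assms(1), of "\<lambda>i. \<xi> i p" v] \<xi>_radical assms(2) by blast
    have "screen_projection p v = 0"
    proof -
      have "screen_projection p v = (\<Sum>i=1..r. c i *\<^sub>R screen_projection p (\<xi> i p))"
        unfolding c by (rule linear_on_sum[OF linear_on_screen_projection subspace_tangent_space \<xi>_tangent])
      moreover have "screen_projection p (\<xi> i p) = 0" if "i \<in> {1..r}" for i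
      proof -
        have "(\<Sum>k=1..r. \<tau> k p (\<xi> i p) *\<^sub>R \<xi> k p) = (\<Sum>k=1..r. if k = i then \<xi> k p else 0)"
          using that by (intro sum.cong) (auto simp: dual)
        then show ?thesis using that by (simp add: screen_projection_def)
      qed
      ultimately show ?thesis by simp
    qed
    then show "v \<in> {0}"
      by (simp add: screen_projection_def \<tau>v)
  qed
  have "0 \<in> tangent_space M p"
    by (rule subspace_0[OF subspace_tangent_space])
  moreover have "gbar p 0 w = 0" if "w \<in> tangent_space M p" for w
    using gbar_tensor that linear_on_zero[OF _ subspace_tangent_space, of M p "\<lambda>u. gbar p u w"]
    by (auto simp: tensor02_def)
  ultimately show "{0} \<subseteq> radical M gbar p"
    by (simp add: radical_def)
qed

end


section \<open>Lie derivatives, exterior derivatives and connections\<close>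

text \<open>Formally a Lie derivative is a covariant derivative in which \<open>\<nabla>\<^sub>X Y\<close> is replaced by
  \<open>[X, Y]\<close>. This lets one computation serve for both.\<close>

lemma lie_deriv_eq_cov_deriv2_bracket: "lie_deriv \<zeta> h X Y p = cov_deriv2 bracket \<zeta> h X Y p"
  by (simp add: lie_deriv_def cov_deriv2_def)

text \<open>This is the Leibniz rule for the derivation \<open>Z p\<close>, valid for any operator \<open>D\<close>. It is used below
  for a connection and for the bracket.\<close>

lemma cov_deriv2_completed_metric:
  assumes "tensor02 M g" "\<And>k. k \<in> {1..r} \<Longrightarrow> one_form M (\<tau> k)"
    and "X \<in> smooth_vfields M" "Y \<in> smooth_vfields M" "Z \<in> smooth_vfields M"
  shows "cov_deriv2 D Z (completed_metric g r \<tau>) X Y p = cov_deriv2 D Z g X Y p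
    + (\<Sum>k=1..r. cov_deriv1 D Z (\<tau> k) X p * \<tau> k p (Y p) + \<tau> k p (X p) * cov_deriv1 D Z (\<tau> k) Y p)"
proof -
  have Z: "Z p \<in> tangent_space M p" by (rule smooth_vfieldD[OF assms(5)])
  have sg: "(\<lambda>q. g q (X q) (Y q)) \<in> smooth_functions M"
    using assms by (auto simp: tensor02_def)
  have s: "(\<lambda>q. \<tau> k q (X q)) \<in> smooth_functions M" "(\<lambda>q. \<tau> k q (Y q)) \<in> smooth_functions M"
    if "k \<in> {1..r}" for k
    using assms that by (auto simp: one_form_def)
  have "Z p (\<lambda>q. g q (X q) (Y q) + (\<Sum>k=1..r. \<tau> k q (X q) * \<tau> k q (Y q)))
      = Z p (\<lambda>q. g q (X q) (Y q)) + Z p (\<lambda>q. \<Sum>k=1..r. \<tau> k q (X q) * \<tau> k q (Y q))"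
    by (intro tangent_add[OF Z] sg smooth_functions_sum smooth_functions_mult s)
  also have "Z p (\<lambda>q. \<Sum>k=1..r. \<tau> k q (X q) * \<tau> k q (Y q))
      = (\<Sum>k=1..r. Z p (\<lambda>q. \<tau> k q (X q) * \<tau> k q (Y q)))"
    by (intro tangent_sum[OF Z] smooth_functions_mult s)
  also have "\<dots> = (\<Sum>k=1..r. Z p (\<lambda>q. \<tau> k q (X q)) * \<tau> k p (Y p)
      + \<tau> k p (X p) * Z p (\<lambda>q. \<tau> k q (Y q)))"
    by (intro sum.cong refl tangent_mult[OF Z] s)
  finally show ?thesis
    by (simp add: cov_deriv2_def cov_deriv1_def completed_metric_def
        sum.distrib sum_subtractf algebra_simps)
qed

locale connection_with_torsion =
  fixes M :: "'a manifold"
    and D :: "'a vfield \<Rightarrow> 'a vfield \<Rightarrow> 'a vfield"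
    and T :: "'a \<Rightarrow> 'a tvec \<Rightarrow> 'a tvec \<Rightarrow> 'a tvec"
  assumes connection: "linear_connection M D"
    and T_tensor: "tensor12 M T"
    and torsion: "has_torsion M D T"
begin

lemma D_tangent: "X \<in> smooth_vfields M \<Longrightarrow> Y \<in> smooth_vfields M \<Longrightarrow> D X Y p \<in> tangent_space M p"
  using connection by (simp add: linear_connection_def smooth_vfieldD)

lemma T_tangent:
  "X \<in> smooth_vfields M \<Longrightarrow> Y \<in> smooth_vfields M \<Longrightarrow> T p (X p) (Y p) \<in> tangent_space M p"
  using T_tensor by (simp add: tensor12_def smooth_vfieldD)

lemma bracket_eq:
  "X \<in> smooth_vfields M \<Longrightarrow> Y \<in> smooth_vfields M
    \<Longrightarrow> bracket X Y p = D X Y p - D Y X p - T p (X p) (Y p)"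
  using torsion by (simp add: has_torsion_def)

text \<open>Torsion expresses the bracket through the connection; in particular the bracket is tangent,
  and a linear form can be evaluated on it term by term.\<close>

lemma linear_on_bracket:
  assumes "linear_on (tangent_space M p) f" "X \<in> smooth_vfields M" "Y \<in> smooth_vfields M"
  shows "f (bracket X Y p) = f (D X Y p) - f (D Y X p) - f (T p (X p) (Y p))"
  using assms
  by (simp add: bracket_eq linear_on_diff[OF assms(1)] subspace_tangent_space D_tangent T_tangent
      subspace_diff)

lemma ext_deriv_eq:
  assumes "one_form M \<alpha>" "X \<in> smooth_vfields M" "Y \<in> smooth_vfields M"
  shows "ext_deriv \<alpha> X Y p
    = cov_deriv1 D X \<alpha> Y p - cov_deriv1 D Y \<alpha> X p + \<alpha> p (T p (X p) (Y p))"
  using linear_on_bracket[OF _ assms(2,3), of p "\<alpha> p"] assms(1)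
  by (simp add: one_form_def ext_deriv_def cov_deriv1_def)

lemma lie_deriv_eq:
  assumes "tensor02 M h" "\<zeta> \<in> smooth_vfields M" "X \<in> smooth_vfields M" "Y \<in> smooth_vfields M"
  shows "lie_deriv \<zeta> h X Y p = cov_deriv2 D \<zeta> h X Y p
    + h p (D X \<zeta> p) (Y p) + h p (X p) (D Y \<zeta> p)
    + h p (T p (\<zeta> p) (X p)) (Y p) + h p (X p) (T p (\<zeta> p) (Y p))"
proof -
  have "linear_on (tangent_space M p) (\<lambda>u. h p u (Y p))" "linear_on (tangent_space M p) (h p (X p))"
    using assms by (auto simp: tensor02_def smooth_vfieldD)
  from linear_on_bracket[OF this(1) assms(2,3)] linear_on_bracket[OF this(2) assms(2,4)]
  show ?thesis
    by (simp add: lie_deriv_def cov_deriv2_def)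
qed

end

context split_degenerate_form
begin

lemma cov_deriv2_gbar:
  assumes "X \<in> smooth_vfields M" "Y \<in> smooth_vfields M" "Z \<in> smooth_vfields M"
  shows "cov_deriv2 D Z gbar X Y p = cov_deriv2 D Z g X Y p
    + (\<Sum>k=1..r. cov_deriv1 D Z (\<tau> k) X p * \<tau> k p (Y p) + \<tau> k p (X p) * cov_deriv1 D Z (\<tau> k) Y p)"
  by (rule cov_deriv2_completed_metric[OF g(1) \<tau> assms])

lemma cov_deriv2_g_\<xi>:
  assumes "linear_connection M D" "\<xi> i \<in> smooth_vfields M"
    "X \<in> smooth_vfields M" "Y \<in> smooth_vfields M" "i \<in> {1..r}"
  shows "cov_deriv2 D X g Y (\<xi> i) p = - g p (Y p) (D X (\<xi> i) p)"
proof -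
  have "(\<lambda>q. g q (Y q) (\<xi> i q)) = (\<lambda>q. 0)"
    using assms by (simp add: g_\<xi> smooth_vfieldD)
  moreover have "D X Y p \<in> tangent_space M p"
    using assms by (simp add: linear_connection_def smooth_vfieldD)
  ultimately show ?thesis
    using assms by (simp add: cov_deriv2_def tangent_const[OF smooth_vfieldD] g_\<xi>)
qed

lemma cov_deriv2_gbar_\<xi>:
  assumes "linear_connection M D" "\<xi> i \<in> smooth_vfields M"
    "X \<in> smooth_vfields M" "Y \<in> smooth_vfields M" "i \<in> {1..r}"
  shows "cov_deriv2 D X gbar Y (\<xi> i) p = cov_deriv1 D X (\<tau> i) Y p - gbar p (Y p) (D X (\<xi> i) p)"
proof -
  have "(\<lambda>q. gbar q (Y q) (\<xi> i q)) = (\<lambda>q. \<tau> i q (Y q))"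
    using assms by (simp add: gbar_\<xi> smooth_vfieldD)
  moreover have "D X Y p \<in> tangent_space M p"
    using assms by (simp add: linear_connection_def smooth_vfieldD)
  ultimately show ?thesis
    using assms by (simp add: cov_deriv2_def cov_deriv1_def gbar_\<xi>)
qed

text \<open>Cartan's formula \<open>L\<^sub>\<xi> \<tau> = \<iota>\<^sub>\<xi> d\<tau> + d(\<tau>(\<xi>))\<close>, whose last term vanishes since \<open>\<tau>(\<xi>)\<close> is
  constant.\<close>

lemma ext_deriv_\<tau>_\<xi>:
  assumes "X \<in> smooth_vfields M" "i \<in> {1..r}" "k \<in> {1..r}"
  shows "ext_deriv (\<tau> k) (\<xi> i) X p = cov_deriv1 bracket (\<xi> i) (\<tau> k) X p"
  using assms by (simp add: ext_deriv_def cov_deriv1_def dual tangent_const[OF smooth_vfieldD])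

end

locale split_form_with_connection = split_degenerate_form M g r \<xi> \<tau> + connection_with_torsion M D T
  for M :: "'a manifold" and g r \<xi> \<tau> D T +
  assumes \<xi>_smooth: "\<And>i. i \<in> {1..r} \<Longrightarrow> \<xi> i \<in> smooth_vfields M"
begin

lemma lie_deriv_g_\<xi>:
  assumes "has_nonmetricity M D g Q"
    and "X \<in> smooth_vfields M" "Y \<in> smooth_vfields M" "i \<in> {1..r}"
  shows "lie_deriv (\<xi> i) g X Y p =
    g p (X p) (T p (\<xi> i p) (Y p)) + g p (Y p) (T p (\<xi> i p) (X p))
    + Q p (\<xi> i p) (X p) (Y p) - Q p (X p) (Y p) (\<xi> i p) - Q p (Y p) (X p) (\<xi> i p)"
proof -
  note \<xi> = \<xi>_smooth[OF assms(4)]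
  have Q: "cov_deriv2 D C g A B p = Q p (C p) (A p) (B p)"
    if "A \<in> smooth_vfields M" "B \<in> smooth_vfields M" "C \<in> smooth_vfields M" for A B C
    using assms(1) that by (auto simp: has_nonmetricity_def)
  have "g p (Y p) (D X (\<xi> i) p) = - Q p (X p) (Y p) (\<xi> i p)"
    "g p (X p) (D Y (\<xi> i) p) = - Q p (Y p) (X p) (\<xi> i p)"
    using cov_deriv2_g_\<xi>[OF connection \<xi> assms(2,3,4), of p]
      cov_deriv2_g_\<xi>[OF connection \<xi> assms(3,2,4), of p] Q \<xi> assms by auto
  moreover have "g p (D X (\<xi> i) p) (Y p) = g p (Y p) (D X (\<xi> i) p)"
    "g p (T p (\<xi> i p) (X p)) (Y p) = g p (Y p) (T p (\<xi> i p) (X p))"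
    by (rule g_sym[OF D_tangent[OF assms(2) \<xi>] smooth_vfieldD[OF assms(3)]],
        rule g_sym[OF T_tangent[OF \<xi> assms(2)] smooth_vfieldD[OF assms(3)]])
  ultimately show ?thesis
    using lie_deriv_eq[OF g(1) \<xi> assms(2,3), of p] Q[OF assms(2,3) \<xi>] by simp
qed

text \<open>The hypothesis on \<open>d\<tau>\<^sub>i\<close> makes \<open>\<nabla>\<tau>\<^sub>i\<close> symmetric. Computing the Lie derivative of the completed
  metric along \<open>\<xi>\<^sub>i\<close> twice, from the hypotheses and from the connection, makes it skew.\<close>

lemma \<tau>_parallel:
  assumes Q: "has_nonmetricity M D gbar Q"
    and ext: "\<And>X Y i p. X \<in> smooth_vfields M \<Longrightarrow> Y \<in> smooth_vfields M \<Longrightarrow> i \<in> {1..r} \<Longrightarrow>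
          ext_deriv (\<tau> i) X Y p = \<tau> i p (T p (X p) (Y p))"
    and lie: "\<And>X Y i p. X \<in> smooth_vfields M \<Longrightarrow> Y \<in> smooth_vfields M \<Longrightarrow> i \<in> {1..r} \<Longrightarrow>
          lie_deriv (\<xi> i) g X Y p =
            g p (X p) (T p (\<xi> i p) (Y p)) + g p (Y p) (T p (\<xi> i p) (X p))
            + Q p (\<xi> i p) (X p) (Y p) - Q p (X p) (Y p) (\<xi> i p) - Q p (Y p) (X p) (\<xi> i p)"
    and i: "i \<in> {1..r}"
  shows "parallel_form M D (\<tau> i)"
  unfolding parallel_form_def
proof (intro ballI allI)
  fix X Y p assume X: "X \<in> smooth_vfields M" and Y: "Y \<in> smooth_vfields M"
  note \<xi> = \<xi>_smooth[OF i]
  have sym: "gbar p v w = gbar p w v" if "v \<in> tangent_space M p" "w \<in> tangent_space M p" for v w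
    using gbar_symmetric that by (simp add: symmetric02_def)
  have Q': "cov_deriv2 D C gbar A B p = Q p (C p) (A p) (B p)"
    if "A \<in> smooth_vfields M" "B \<in> smooth_vfields M" "C \<in> smooth_vfields M" for A B C
    using Q that by (auto simp: has_nonmetricity_def)
  have symm: "cov_deriv1 D X (\<tau> i) Y p = cov_deriv1 D Y (\<tau> i) X p"
    using ext_deriv_eq[OF \<tau>[OF i] X Y, of p] ext[OF X Y i, of p] by simp
  have lie_\<tau>: "cov_deriv1 bracket (\<xi> i) (\<tau> k) A p = \<tau> k p (T p (\<xi> i p) (A p))"
    if "k \<in> {1..r}" "A \<in> smooth_vfields M" for k A
    using ext_deriv_\<tau>_\<xi>[OF that(2) i that(1)] ext[OF \<xi> that(2,1)] by simp
  have "lie_deriv (\<xi> i) gbar X Y p = lie_deriv (\<xi> i) g X Y p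
      + (\<Sum>k=1..r. \<tau> k p (T p (\<xi> i p) (X p)) * \<tau> k p (Y p) + \<tau> k p (X p) * \<tau> k p (T p (\<xi> i p) (Y p)))"
    unfolding lie_deriv_eq_cov_deriv2_bracket cov_deriv2_gbar[OF X Y \<xi>]
    by (intro arg_cong2[where f = "(+)"] sum.cong refl) (simp_all only: lie_\<tau> X Y)
  \<comment> \<open>The correction terms are exactly what turns \<open>g\<close> into the completed metric in the torsion terms.\<close>
  then have "lie_deriv (\<xi> i) gbar X Y p =
      gbar p (X p) (T p (\<xi> i p) (Y p)) + gbar p (Y p) (T p (\<xi> i p) (X p))
      + Q p (\<xi> i p) (X p) (Y p) - Q p (X p) (Y p) (\<xi> i p) - Q p (Y p) (X p) (\<xi> i p)"
    unfolding lie[OF X Y i] completed_metric_def by (simp add: sum.distrib mult.commute)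
  moreover have "lie_deriv (\<xi> i) gbar X Y p = Q p (\<xi> i p) (X p) (Y p)
      + gbar p (Y p) (D X (\<xi> i) p) + gbar p (X p) (D Y (\<xi> i) p)
      + gbar p (Y p) (T p (\<xi> i p) (X p)) + gbar p (X p) (T p (\<xi> i p) (Y p))"
    unfolding lie_deriv_eq[OF gbar_tensor \<xi> X Y] Q'[OF X Y \<xi>]
    using sym[OF D_tangent[OF X \<xi>] smooth_vfieldD[OF Y]]
      sym[OF T_tangent[OF \<xi> X] smooth_vfieldD[OF Y]] by simp
  moreover have
    "Q p (X p) (Y p) (\<xi> i p) = cov_deriv1 D X (\<tau> i) Y p - gbar p (Y p) (D X (\<xi> i) p)"
    "Q p (Y p) (X p) (\<xi> i p) = cov_deriv1 D Y (\<tau> i) X p - gbar p (X p) (D Y (\<xi> i) p)"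
    using cov_deriv2_gbar_\<xi>[OF connection \<xi> X Y i, of p] cov_deriv2_gbar_\<xi>[OF connection \<xi> Y X i, of p]
      Q'[OF Y \<xi> X] Q'[OF X \<xi> Y] by auto
  ultimately have "cov_deriv1 D X (\<tau> i) Y p + cov_deriv1 D Y (\<tau> i) X p = 0"
    by simp
  with symm show "cov_deriv1 D X (\<tau> i) Y p = 0" by simp
qed

lemma nonmetricity_g_iff_gbar:
  assumes "\<And>i. i \<in> {1..r} \<Longrightarrow> parallel_form M D (\<tau> i)"
  shows "has_nonmetricity M D g Q \<longleftrightarrow> has_nonmetricity M D gbar Q"
proof -
  have "cov_deriv2 D Z gbar X Y p = cov_deriv2 D Z g X Y p"
    if "X \<in> smooth_vfields M" "Y \<in> smooth_vfields M" "Z \<in> smooth_vfields M" for X Y Z p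
    unfolding cov_deriv2_gbar[OF that]
    using assms that by (simp add: parallel_form_def)
  then show ?thesis
    by (simp add: has_nonmetricity_def)
qed

end


section \<open>Connections on light-like manifolds\<close>

theorem theorem1p3:
  fixes M :: "'a::{t2_space, second_countable_topology} manifold"
    and g gbar :: "'a \<Rightarrow> 'a tvec \<Rightarrow> 'a tvec \<Rightarrow> real"
    and r :: nat
    and \<xi> :: "nat \<Rightarrow> 'a vfield"
    and \<tau> :: "nat \<Rightarrow> 'a \<Rightarrow> 'a tvec \<Rightarrow> real"
  assumes "light_like_manifold M g r"
    and "\<And>i. i \<in> {1..r} \<Longrightarrow> \<xi> i \<in> smooth_vfields M"
    and "\<And>i p. i \<in> {1..r} \<Longrightarrow> \<xi> i p \<in> radical M g p"
    and "\<And>p c. (\<Sum>i=1..r. c i *\<^sub>R \<xi> i p) = 0 \<Longrightarrow> \<forall>i\<in>{1..r}. c i = 0"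
    and "\<And>i. i \<in> {1..r} \<Longrightarrow> one_form M (\<tau> i)"
    and "\<And>i j p. i \<in> {1..r} \<Longrightarrow> j \<in> {1..r} \<Longrightarrow> \<tau> i p (\<xi> j p) = (if i = j then 1 else 0)"
    and gbar: "gbar = (\<lambda>p v w. g p v w + (\<Sum>k=1..r. \<tau> k p v * \<tau> k p w))"
  shows "nondegenerate_metric M gbar \<and>
    (\<forall>D T Q.
       linear_connection M D \<and> tensor12 M T \<and> tensor03 M Q \<and>
       has_torsion M D T \<and> has_nonmetricity M D g Q \<and>
       (\<forall>i\<in>{1..r}. parallel_form M D (\<tau> i)) \<longrightarrow>
       (\<forall>X\<in>smooth_vfields M. \<forall>Y\<in>smooth_vfields M. \<forall>i\<in>{1..r}. \<forall>p.
          ext_deriv (\<tau> i) X Y p = \<tau> i p (T p (X p) (Y p)) \<and>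
          lie_deriv (\<xi> i) g X Y p =
            g p (X p) (T p (\<xi> i p) (Y p)) + g p (Y p) (T p (\<xi> i p) (X p))
            + Q p (\<xi> i p) (X p) (Y p) - Q p (X p) (Y p) (\<xi> i p) - Q p (Y p) (X p) (\<xi> i p))) \<and>
    (\<forall>T Q.
       tensor12 M T \<and> antisymmetric12 M T \<and> tensor03 M Q \<and> symmetric_last M Q \<and>
       (\<forall>X\<in>smooth_vfields M. \<forall>Y\<in>smooth_vfields M. \<forall>i\<in>{1..r}. \<forall>p.
          ext_deriv (\<tau> i) X Y p = \<tau> i p (T p (X p) (Y p)) \<and>
          lie_deriv (\<xi> i) g X Y p =
            g p (X p) (T p (\<xi> i p) (Y p)) + g p (Y p) (T p (\<xi> i p) (X p))
            + Q p (\<xi> i p) (X p) (Y p) - Q p (X p) (Y p) (\<xi> i p) - Q p (Y p) (X p) (\<xi> i p)) \<longrightarrow>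
       (\<forall>D. linear_connection M D \<and> has_torsion M D T \<and> has_nonmetricity M D gbar Q \<longrightarrow>
          has_nonmetricity M D g Q \<and> (\<forall>i\<in>{1..r}. parallel_form M D (\<tau> i))))"
proof -
  interpret split_degenerate_form M g r \<xi> \<tau>
    using assms(1-6) by unfold_locales (auto simp: light_like_manifold_def)
  have gb: "gbar = completed_metric g r \<tau>"
    by (simp add: gbar completed_metric_def)
  have conn: "split_form_with_connection M g r \<xi> \<tau> D T"
    if "linear_connection M D" "tensor12 M T" "has_torsion M D T" for D T
    using that assms(2) by unfold_locales auto
  obtain q where q: "\<And>p. has_index M g p q" and rad: "\<And>p. has_dimension (radical M g p) r"
    using assms(1) by (auto simp: light_like_manifold_def)
  have metric: "nondegenerate_metric M gbar"
    unfolding nondegenerate_metric_def gb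
  proof (intro conjI allI)
    show "\<exists>q. \<forall>p. has_index M (completed_metric g r \<tau>) p q"
      using index_gbar[OF q] by blast
    show "radical M (completed_metric g r \<tau>) p = {0}" for p
      by (rule radical_gbar[OF rad assms(4)])
  qed (rule gbar_tensor gbar_symmetric)+
  show ?thesis
  proof (intro conjI allI impI ballI)
    show "nondegenerate_metric M gbar" by (rule metric)
  next
    fix D T Q X Y i p
    assume H: "linear_connection M D \<and> tensor12 M T \<and> tensor03 M Q \<and>
       has_torsion M D T \<and> has_nonmetricity M D g Q \<and> (\<forall>i\<in>{1..r}. parallel_form M D (\<tau> i))"
      and XY: "X \<in> smooth_vfields M" "Y \<in> smooth_vfields M" and i: "i \<in> {1..r}"
    interpret split_form_with_connection M g r \<xi> \<tau> D T
      using H by (intro conn) auto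
    show "ext_deriv (\<tau> i) X Y p = \<tau> i p (T p (X p) (Y p))"
      using ext_deriv_eq[OF \<tau>[OF i] XY, of p] H XY i by (simp add: parallel_form_def)
    show "lie_deriv (\<xi> i) g X Y p =
            g p (X p) (T p (\<xi> i p) (Y p)) + g p (Y p) (T p (\<xi> i p) (X p))
            + Q p (\<xi> i p) (X p) (Y p) - Q p (X p) (Y p) (\<xi> i p) - Q p (Y p) (X p) (\<xi> i p)"
      using H XY i by (intro lie_deriv_g_\<xi>) auto
  next
    fix T Q D
    assume H: "tensor12 M T \<and> antisymmetric12 M T \<and> tensor03 M Q \<and> symmetric_last M Q \<and>
       (\<forall>X\<in>smooth_vfields M. \<forall>Y\<in>smooth_vfields M. \<forall>i\<in>{1..r}. \<forall>p.
          ext_deriv (\<tau> i) X Y p = \<tau> i p (T p (X p) (Y p)) \<and>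
          lie_deriv (\<xi> i) g X Y p =
            g p (X p) (T p (\<xi> i p) (Y p)) + g p (Y p) (T p (\<xi> i p) (X p))
            + Q p (\<xi> i p) (X p) (Y p) - Q p (X p) (Y p) (\<xi> i p) - Q p (Y p) (X p) (\<xi> i p))"
      and HD: "linear_connection M D \<and> has_torsion M D T \<and> has_nonmetricity M D gbar Q"
    interpret split_form_with_connection M g r \<xi> \<tau> D T
      using H HD by (intro conn) auto
    have par: "parallel_form M D (\<tau> i)" if "i \<in> {1..r}" for i
      by (rule \<tau>_parallel[OF _ _ _ that, of Q]) (use H HD gb in auto)
    show "has_nonmetricity M D g Q"
      using nonmetricity_g_iff_gbar[OF par] HD gb by blast
    show "parallel_form M D (\<tau> i)" if "i \<in> {1..r}" for i
      by (rule par[OF that])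
  qed
qed

end
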